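(* Consider linear structural causal models on the graph $X_1\to Y\to X_2$ with $Y=X_1+U_Y$ and $X_2=\alpha_2Y+U_2$, where $\alpha_2>0$ and all exogenous variables have mean $0$. For each of the following two items there exists a choice, for every sufficiently small $\epsilon>0$, of such a model and of a cost structure, for which the optimal improvement over all mechanisms is $1$ and such that (asymptotics as $\epsilon\to0$): 1. Any mechanism with low risk $o(\epsilon)$ has improvement at most $O(\epsilon)$; i.e. for every family of mechanisms $(f_\epsilon)$ such that $f_\epsilon$ has risk $o(\epsilon)$ in the $\epsilon$-th model, the improvement of $f_\epsilon$ in the $\epsilon$-th model is at most $O(\epsilon)$. 2. There is a mechanism $f$ that is a function of only the proxy $X_2$, has low risk $o(\epsilon)$, and has improvement at least $1-\epsilon$.
   Context: Setting. $X_1,X_2$ are real-valued features and $Y$ is a real-valued outcome; $X_1=U_1$, and the exogenous variables $U_1,U_Y,U_2$ are mutually independent with mean zero (their distributions are part of the choice of the model). $X_2$, a descendant of $Y$, is called the proxy. The natural distribution $\mathcal{D}_0$ is the law of $(X_1,X_2,Y)$. A cost structure consists of a cost function $c(a_1,a_2)$ and a budget $b$. A mechanism is a function $f:\mathbb{R}^2\to\mathbb{R}$ of the features. Facing $f$, an individual with realized $u_1,u_Y,u_2$ chooses $a^*=(a_1^*,a_2^* )$ maximizing $f(x'_1,x'_2)$ over $a\in\mathbb{R}^2$ with $c(a_1,a_2)\le b$, where $x_1'=u_1+a_1$, $y'=x_1'+u_Y$, $x_2'=\alpha_2y'+u_2+a_2$ (the outcome $Y$ cannot be intervened on directly). The resulting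 variables, with $a=a^*$, are $\tilde X_1,\tilde Y,\tilde X_2$; their law is the induced distribution $\mathcal{D}(f)$. The improvement of $f$ is $\mathbb{E}_{\mathcal{D}(f)}[\tilde Y]-\mathbb{E}_{\mathcal{D}_0}[Y]$, and its risk is $\mathbb{E}_{\mathcal{D}(f)}[(f(\tilde X_1,\tilde X_2)-\tilde Y)^2]$. *)

theory Defs
  imports "HOL-Probability.Probability" "HOL-Library.Landau_Symbols"
begin

record model =
  law_U1 :: "real measure"
  law_UY :: "real measure"
  law_U2 :: "real measure"
  alpha2 :: real

record cost_structure =
  cost :: "real \<Rightarrow> real \<Rightarrow> real"
  budget :: real

definition mean_zero_law :: "real measure \<Rightarrow> bool" where
  "mean_zero_law \<mu> \<longleftrightarrow> prob_space \<mu> \<and> sets \<mu> = sets borel \<and>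
     integrable \<mu> (\<lambda>u. u) \<and> (\<integral>u. u \<partial>\<mu>) = 0"

definition linear_scm :: "model \<Rightarrow> bool" where
  "linear_scm M \<longleftrightarrow> mean_zero_law (law_U1 M) \<and> mean_zero_law (law_UY M) \<and>
     mean_zero_law (law_U2 M) \<and> alpha2 M > 0"

text \<open>The joint law of \<open>(U1, UY, U2)\<close>; the product measure expresses mutual independence.\<close>

definition exogenous :: "model \<Rightarrow> (real \<times> real \<times> real) measure" where
  "exogenous M = law_U1 M \<Otimes>\<^sub>M law_UY M \<Otimes>\<^sub>M law_U2 M"

text \<open>The triple \<open>(x1, x2, y)\<close> of an individual with noise \<open>(u1, uY, u2)\<close> and action \<open>(a1, a2)\<close>.\<close>

fun variables :: "model \<Rightarrow> real \<times> real \<times> real \<Rightarrow> real \<times> real \<Rightarrow> real \<times> real \<times> real" where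
  "variables M (u1, uY, u2) (a1, a2) =
     (let x1 = u1 + a1; y = x1 + uY; x2 = alpha2 M * y + u2 + a2 in (x1, x2, y))"

fun score :: "(real \<Rightarrow> real \<Rightarrow> real) \<Rightarrow> real \<times> real \<times> real \<Rightarrow> real" where
  "score f (x1, x2, y) = f x1 x2"

fun outcome :: "real \<times> real \<times> real \<Rightarrow> real" where
  "outcome (x1, x2, y) = y"

fun feasible :: "cost_structure \<Rightarrow> real \<times> real \<Rightarrow> bool" where
  "feasible C (a1, a2) \<longleftrightarrow> cost C a1 a2 \<le> budget C"

text \<open>A maximizing action need neither exist nor be unique, so best responses form a relation:
  \<open>a\<close> is any measurable rule that selects a maximizer for almost every realization of the noise.
  The mechanism \<open>f\<close> is an arbitrary function.\<close>

definition best_response ::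
  "model \<Rightarrow> cost_structure \<Rightarrow> (real \<Rightarrow> real \<Rightarrow> real) \<Rightarrow>
   (real \<times> real \<times> real \<Rightarrow> real \<times> real) \<Rightarrow> bool" where
  "best_response M C f a \<longleftrightarrow> a \<in> borel_measurable (exogenous M) \<and>
     (AE u in exogenous M. is_arg_max (\<lambda>a'. score f (variables M u a')) (feasible C) (a u))"

definition induced ::
  "model \<Rightarrow> (real \<times> real \<times> real \<Rightarrow> real \<times> real) \<Rightarrow> (real \<times> real \<times> real) measure" where
  "induced M a = distr (exogenous M) borel (\<lambda>u. variables M u (a u))"

definition natural :: "model \<Rightarrow> (real \<times> real \<times> real) measure" where
  "natural M = induced M (\<lambda>_. (0, 0))"

text \<open>This is meaningful only if the outcome is integrable under the induced law, which
  \<open>optimal_improvement\<close> below demands of every mechanism and every best response.\<close>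

definition improvement :: "model \<Rightarrow> (real \<times> real \<times> real \<Rightarrow> real \<times> real) \<Rightarrow> real" where
  "improvement M a = (\<integral>z. outcome z \<partial>induced M a) - (\<integral>z. outcome z \<partial>natural M)"

text \<open>The risk takes values in \<open>[0, \<infinity>]\<close>. If \<open>f\<close> is not measurable, the integral is a lower
  integral, and an upper bound on the risk is then the weaker hypothesis.\<close>

definition risk ::
  "model \<Rightarrow> (real \<Rightarrow> real \<Rightarrow> real) \<Rightarrow> (real \<times> real \<times> real \<Rightarrow> real \<times> real) \<Rightarrow> ennreal" where
  "risk M f a = (\<integral>\<^sup>+ z. ennreal ((score f z - outcome z)\<^sup>2) \<partial>induced M a)"

text \<open>Some best response to \<open>f\<close> exists, and \<open>P\<close> holds however ties are broken.\<close>

definition for_all_responses ::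
  "model \<Rightarrow> cost_structure \<Rightarrow> (real \<Rightarrow> real \<Rightarrow> real) \<Rightarrow>
   ((real \<times> real \<times> real \<Rightarrow> real \<times> real) \<Rightarrow> bool) \<Rightarrow> bool" where
  "for_all_responses M C f P \<longleftrightarrow>
     (\<exists>a. best_response M C f a) \<and> (\<forall>a. best_response M C f a \<longrightarrow> P a)"

text \<open>The optimum is a maximum: it bounds the (finite) improvement of every mechanism under every
  tie-breaking, and some mechanism attains it under every tie-breaking.\<close>

definition optimal_improvement :: "model \<Rightarrow> cost_structure \<Rightarrow> real \<Rightarrow> bool" where
  "optimal_improvement M C v \<longleftrightarrow>
     (\<exists>f. for_all_responses M C f (\<lambda>a. improvement M a = v)) \<and>
     (\<forall>f a. best_response M C f a \<longrightarrow>
        integrable (induced M a) outcome \<and> improvement M a \<le> v)"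

end

theory Submission
  imports Defs
begin

text \<open>
  Both items use the same population: \<open>U1 = U2 = 0\<close>, \<open>\<alpha>2 = 1\<close>, and \<open>UY\<close> equals \<open>\<epsilon>\<close> for the common
  individuals and \<open>\<epsilon> - 1\<close> for the rare ones, who have probability \<open>\<epsilon>\<close>.

  For item 1, only \<open>(0, 0)\<close> and the actions with \<open>a1 = 1\<close> and arbitrary \<open>a2\<close> are affordable. If a
  mechanism makes the common individuals improve, then the rare ones can reach the same features with
  an outcome that is smaller by \<open>1\<close>, while their score is at least as large. So the score of one of
  the two groups is off by at least \<open>1/2\<close>, and the risk is at least \<open>\<epsilon>/4\<close>. Hence a mechanism with risk
  \<open>o(\<epsilon>)\<close> can only improve the rare individuals, by at most \<open>\<epsilon>\<close> in total.

  For item 2, the proxy cannot be gamed, so \<open>X2 = Y\<close> throughout and \<open>X2\<close> itself is a mechanism of risk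
  \<open>0\<close> that rewards improvement.
\<close>

section \<open>Products with a point mass\<close>

text \<open>With \<open>U1\<close> and \<open>U2\<close> constant, this lemma and the next collapse
  the exogenous product law to a push-forward of the law of \<open>UY\<close>. Their hypotheses
  differ because \<open>emeasure_pair_measure_alt\<close> asks sigma-finiteness of the second factor
  only.\<close>

lemma return_pair_measure:
  assumes "sigma_finite_measure N" and "x \<in> space M"
  shows "return M x \<Otimes>\<^sub>M N = distr N (M \<Otimes>\<^sub>M N) (Pair x)"
proof (rule measure_eqI)
  interpret sigma_finite_measure N by fact
  show "sets (return M x \<Otimes>\<^sub>M N) = sets (distr N (M \<Otimes>\<^sub>M N) (Pair x))"
    by (simp cong: sets_pair_measure_cong)
  fix A assume "A \<in> sets (return M x \<Otimes>\<^sub>M N)"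
  then have A: "A \<in> sets (M \<Otimes>\<^sub>M N)"
    by (simp cong: sets_pair_measure_cong)
  have "emeasure (return M x \<Otimes>\<^sub>M N) A = (\<integral>\<^sup>+ y. emeasure N (Pair y -` A) \<partial>return M x)"
    using \<open>A \<in> sets (return M x \<Otimes>\<^sub>M N)\<close> by (rule emeasure_pair_measure_alt)
  also have "\<dots> = emeasure N (Pair x -` A)"
    using A assms(2) by (intro nn_integral_return measurable_emeasure_Pair)
  also have "\<dots> = emeasure (distr N (M \<Otimes>\<^sub>M N) (Pair x)) A"
    using A assms(2) sets.sets_into_space[OF A]
    by (subst emeasure_distr) (auto intro!: arg_cong[where f = "emeasure N"] simp: space_pair_measure)
  finally show "emeasure (return M x \<Otimes>\<^sub>M N) A = emeasure (distr N (M \<Otimes>\<^sub>M N) (Pair x)) A" .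
qed

lemma pair_measure_return:
  assumes "y \<in> space N"
  shows "M \<Otimes>\<^sub>M return N y = distr M (M \<Otimes>\<^sub>M N) (\<lambda>x. (x, y))"
proof (rule measure_eqI)
  interpret prob_space "return N y" using assms by (rule prob_space_return)
  show "sets (M \<Otimes>\<^sub>M return N y) = sets (distr M (M \<Otimes>\<^sub>M N) (\<lambda>x. (x, y)))"
    by (simp cong: sets_pair_measure_cong)
  fix A assume A': "A \<in> sets (M \<Otimes>\<^sub>M return N y)"
  then have A: "A \<in> sets (M \<Otimes>\<^sub>M N)"
    by (simp cong: sets_pair_measure_cong)
  have "emeasure (M \<Otimes>\<^sub>M return N y) A = (\<integral>\<^sup>+ x. emeasure (return N y) (Pair x -` A) \<partial>M)"
    using A' by (rule emeasure_pair_measure_alt)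
  also have "\<dots> = (\<integral>\<^sup>+ x. indicator ((\<lambda>x. (x, y)) -` A \<inter> space M) x \<partial>M)"
    using sets_Pair1[OF A] by (intro nn_integral_cong) (simp add: indicator_def)
  also have "\<dots> = emeasure (distr M (M \<Otimes>\<^sub>M N) (\<lambda>x. (x, y))) A"
    using A assms by (subst emeasure_distr) (auto intro!: nn_integral_indicator)
  finally show "emeasure (M \<Otimes>\<^sub>M return N y) A = emeasure (distr M (M \<Otimes>\<^sub>M N) (\<lambda>x. (x, y))) A" .
qed

section \<open>The two-point population\<close>

definition noise :: "real \<Rightarrow> bool \<Rightarrow> real" where
  "noise \<epsilon> rare = (if rare then \<epsilon> - 1 else \<epsilon>)"

definition population :: "real \<Rightarrow> model" where
  "population \<epsilon> = \<lparr>law_U1 = return borel 0,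
     law_UY = distr (measure_pmf (bernoulli_pmf \<epsilon>)) borel (noise \<epsilon>),
     law_U2 = return borel 0, alpha2 = 1\<rparr>"

definition individual :: "real \<Rightarrow> bool \<Rightarrow> real \<times> real \<times> real" where
  "individual \<epsilon> rare = (0, noise \<epsilon> rare, 0)"

lemma exogenous_population:
  "exogenous (population \<epsilon>) = distr (measure_pmf (bernoulli_pmf \<epsilon>)) borel (individual \<epsilon>)"
proof -
  let ?N = "distr (measure_pmf (bernoulli_pmf \<epsilon>)) borel (\<lambda>b. (noise \<epsilon> b, 0 :: real))"
  have "law_UY (population \<epsilon>) \<Otimes>\<^sub>M law_U2 (population \<epsilon>) = ?N"
    by (simp add: population_def pair_measure_return distr_distr comp_def)
      (rule distr_cong; simp flip: borel_prod cong: sets_pair_measure_cong)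
  moreover have "return borel 0 \<Otimes>\<^sub>M ?N = distr ?N (borel \<Otimes>\<^sub>M ?N) (Pair (0 :: real))"
    by (intro return_pair_measure finite_measure.axioms(1) prob_space.finite_measure
        prob_space.prob_space_distr prob_space_measure_pmf) auto
  \<comment> \<open>\<open>?N\<close> carries the Borel sigma-algebra of pairs, so the product
    sigma-algebra is the Borel one on triples.\<close>
  moreover have "distr ?N (borel \<Otimes>\<^sub>M ?N) (Pair (0 :: real)) = distr ?N borel (Pair 0)"
    by (rule distr_cong) (auto simp flip: borel_prod cong: sets_pair_measure_cong)
  moreover have "\<dots> = distr (measure_pmf (bernoulli_pmf \<epsilon>)) borel (individual \<epsilon>)"
    by (subst distr_distr) (simp_all add: individual_def [abs_def] comp_def)
  ultimately show ?thesis
    by (simp add: exogenous_def population_def)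
qed

lemma linear_scm_population:
  assumes "0 < \<epsilon>" "\<epsilon> < 1"
  shows "linear_scm (population \<epsilon>)"
proof -
  have "integrable (return borel 0) (\<lambda>u :: real. u)"
  proof (rule integrable_cong_AE_imp[OF integrable_zero])
    show "AE u in return borel (0 :: real). 0 = u"
      by (subst AE_return) simp_all
  qed simp
  moreover have "prob_space (return borel (0 :: real))"
    by (rule prob_space_return) simp
  moreover have "(\<integral>u. u \<partial>return borel (0 :: real)) = 0"
    by (rule integral_return) simp_all
  ultimately have "mean_zero_law (return borel 0)"
    unfolding mean_zero_law_def by (simp only: sets_return)
  \<comment> \<open>The mean is \<epsilon> * (\<epsilon> - 1) + (1 - \<epsilon>) * \<epsilon> =
    0.\<close>
  moreover have "mean_zero_law (law_UY (population \<epsilon>))"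
    using assms
    by (auto simp: mean_zero_law_def population_def noise_def integral_distr integrable_distr_eq
        integrable_measure_pmf_finite algebra_simps
        intro!: prob_space.prob_space_distr prob_space_measure_pmf)
  ultimately show ?thesis
    by (simp add: linear_scm_def population_def)
qed

section \<open>Best responses, improvement and risk in the population\<close>

abbreviation reached ::
  "real \<Rightarrow> (real \<times> real \<times> real \<Rightarrow> real \<times> real) \<Rightarrow> bool \<Rightarrow> real \<times> real \<times> real" where
  "reached \<epsilon> a b \<equiv> variables (population \<epsilon>) (individual \<epsilon> b) (a (individual \<epsilon> b))"

lemma variables_population:
  "variables (population \<epsilon>) (individual \<epsilon> b) a =
     (fst a, fst a + noise \<epsilon> b + snd a, fst a + noise \<epsilon> b)"
  by (cases a) (simp add: individual_def population_def Let_def)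

lemma outcome_measurable [measurable]: "outcome \<in> borel_measurable borel"
proof -
  have *: "outcome = (\<lambda>z. snd (snd z))"
    by auto
  show ?thesis
    unfolding * by (intro borel_measurable_continuous_onI continuous_intros)
qed

lemma induced_population:
  assumes "a \<in> borel_measurable (exogenous (population \<epsilon>))"
  shows "induced (population \<epsilon>) a = distr (measure_pmf (bernoulli_pmf \<epsilon>)) borel (reached \<epsilon> a)"
proof -
  \<comment> \<open>Borel spaces of tuples are rewritten as products, so that
    \<open>measurable\<close> can work coordinate by coordinate.\<close>
  have [measurable]: "a \<in> borel \<Otimes>\<^sub>M borel \<Otimes>\<^sub>M borel \<rightarrow>\<^sub>M borel \<Otimes>\<^sub>M borel"
    using assms by (simp add: exogenous_population borel_prod)
  have "(\<lambda>u. variables (population \<epsilon>) u (a u)) =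
      (\<lambda>u. (fst u + fst (a u), fst u + fst (a u) + fst (snd u) + snd (snd u) + snd (a u),
        fst u + fst (a u) + fst (snd u)))"
    by (rule ext) (metis (no_types, lifting) variables.simps prod.collapse Let_def population_def
        model.select_convs(4) mult_1)
  also have "\<dots> \<in> borel \<Otimes>\<^sub>M borel \<Otimes>\<^sub>M borel \<rightarrow>\<^sub>M borel \<Otimes>\<^sub>M borel \<Otimes>\<^sub>M borel"
    by measurable
  finally have "(\<lambda>u. variables (population \<epsilon>) u (a u)) \<in> borel \<rightarrow>\<^sub>M borel"
    by (simp add: borel_prod)
  then show ?thesis
    by (simp add: induced_def exogenous_population distr_distr comp_def)
qed

text \<open>For 0 < \<epsilon> < 1 both individuals have positive probability, so neither may be
  neglected by an almost-everywhere condition.\<close>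

lemma best_response_population:
  assumes "0 < \<epsilon>" "\<epsilon> < 1"
  shows "best_response (population \<epsilon>) C f a \<longleftrightarrow>
     a \<in> borel_measurable (exogenous (population \<epsilon>)) \<and>
     (\<forall>b. is_arg_max (\<lambda>a'. score f (variables (population \<epsilon>) (individual \<epsilon> b) a')) (feasible C)
       (a (individual \<epsilon> b)))"
proof -
  have "(AE u in exogenous (population \<epsilon>). P u) \<longleftrightarrow> (\<forall>b. P (individual \<epsilon> b))" for P
  proof
    assume "AE u in exogenous (population \<epsilon>). P u"
    then have "AE b in measure_pmf (bernoulli_pmf \<epsilon>). P (individual \<epsilon> b)"
      unfolding exogenous_population by (rule AE_distrD[rotated]) simp
    then show "\<forall>b. P (individual \<epsilon> b)"
      using assms by (simp add: AE_measure_pmf_iff set_pmf_bernoulli)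
  next
    assume P: "\<forall>b. P (individual \<epsilon> b)"
    \<comment> \<open>\<open>P\<close> may fail to be measurable, since mechanisms are arbitrary.
      The finite, hence Borel, set of individuals carries the law instead.\<close>
    let ?S = "range (individual \<epsilon>)"
    have S: "?S \<in> sets borel"
      by (intro borel_closed finite_imp_closed) simp
    then have "AE u in exogenous (population \<epsilon>). u \<in> ?S"
      by (subst exogenous_population, subst AE_distr_iff) auto
    then show "AE u in exogenous (population \<epsilon>). P u"
      using P by (auto elim!: eventually_mono)
  qed
  then show ?thesis
    by (simp add: best_response_def)
qed

lemma outcome_integrable_induced:
  assumes "a \<in> borel_measurable (exogenous (population \<epsilon>))"
  shows "integrable (induced (population \<epsilon>) a) outcome"
  using assms
  by (simp add: induced_population integrable_distr_eq integrable_measure_pmf_finite)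

text \<open>The outcome is \<open>a1\<close> plus the noise, and the noise cancels against the
  natural law. Only the mean of \<open>a1\<close> remains.\<close>

lemma improvement_population:
  assumes "0 < \<epsilon>" "\<epsilon> < 1" and "a \<in> borel_measurable (exogenous (population \<epsilon>))"
  shows "improvement (population \<epsilon>) a =
     \<epsilon> * fst (a (individual \<epsilon> True)) + (1 - \<epsilon>) * fst (a (individual \<epsilon> False))"
  using assms
  by (simp add: improvement_def natural_def induced_population integral_distr variables_population
      algebra_simps)

text \<open>Since the induced law has atoms, this needs no measurability of \<open>f\<close>.\<close>

lemma risk_ge_atom:
  assumes a: "a \<in> borel_measurable (exogenous (population \<epsilon>))"
  shows "ennreal (pmf (bernoulli_pmf \<epsilon>) b * (score f (reached \<epsilon> a b) - outcome (reached \<epsilon> a b))\<^sup>2)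
     \<le> risk (population \<epsilon>) f a"
proof -
  let ?z = "reached \<epsilon> a b"
  let ?D = "induced (population \<epsilon>) a"
  let ?e = "\<lambda>z. ennreal ((score f z - outcome z)\<^sup>2)"
  have D: "?D = distr (measure_pmf (bernoulli_pmf \<epsilon>)) borel (reached \<epsilon> a)"
    using a by (rule induced_population)
  have "ennreal (pmf (bernoulli_pmf \<epsilon>) b) = emeasure (bernoulli_pmf \<epsilon>) {b}"
    by (simp add: emeasure_pmf_single)
  \<comment> \<open>Only an inequality, because both individuals may reach the same point.\<close>
  also have "\<dots> \<le> emeasure (bernoulli_pmf \<epsilon>) (reached \<epsilon> a -` {?z} \<inter> UNIV)"
    by (intro emeasure_mono) auto
  also have "\<dots> = emeasure ?D {?z}"
    unfolding D by (subst emeasure_distr) auto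
  finally have "ennreal (pmf (bernoulli_pmf \<epsilon>) b) * ?e ?z \<le> emeasure ?D {?z} * ?e ?z"
    by (rule mult_right_mono) simp
  also have "\<dots> = (\<integral>\<^sup>+ z. ?e ?z * indicator {?z} z \<partial>?D)"
    by (subst nn_integral_cmult_indicator) (auto simp: D mult.commute)
  also have "\<dots> \<le> risk (population \<epsilon>) f a"
    unfolding risk_def by (intro nn_integral_mono) (auto simp: indicator_def)
  finally show ?thesis
    by (simp add: ennreal_mult)
qed

text \<open>Scoring by \<open>x1\<close>, which equals \<open>a1\<close> here, makes everyone
  maximize \<open>a1\<close>. No mechanism does better, as the improvement is a weighted mean of
  values of \<open>a1\<close>.\<close>

lemma optimal_improvement_population:
  assumes "0 < \<epsilon>" "\<epsilon> < 1" and "feasible C (1, 0)" and le: "\<And>a. feasible C a \<Longrightarrow> fst a \<le> 1"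
  shows "optimal_improvement (population \<epsilon>) C 1"
  unfolding optimal_improvement_def for_all_responses_def
proof (intro conjI exI allI impI)
  note br = best_response_population[OF assms(1,2)]
  note impr = improvement_population[OF assms(1,2)]
  show "best_response (population \<epsilon>) C (\<lambda>x1 x2. x1) (\<lambda>_. (1, 0))"
    unfolding br using assms(3) le by (auto simp: is_arg_max_def variables_population not_less)
  show "improvement (population \<epsilon>) a = 1"
    if "best_response (population \<epsilon>) C (\<lambda>x1 x2. x1) a" for a
  proof -
    \<comment> \<open>Ties in \<open>a2\<close> are possible, but every maximizer has the same
      \<open>a1\<close>.\<close>
    have "fst (a (individual \<epsilon> b)) = 1" for b
    proof (rule antisym)
      have "is_arg_max fst (feasible C) (a (individual \<epsilon> b))"
        using that by (simp add: br variables_population)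
      then show "fst (a (individual \<epsilon> b)) \<le> 1" "1 \<le> fst (a (individual \<epsilon> b))"
        using assms(3) le unfolding is_arg_max_def by (auto simp only: fst_conv not_less)
    qed
    then show ?thesis
      using that by (simp add: br impr)
  qed
  fix f a
  assume a: "best_response (population \<epsilon>) C f a"
  show "integrable (induced (population \<epsilon>) a) outcome"
    using a by (simp add: br outcome_integrable_induced)
  have "fst (a (individual \<epsilon> b)) \<le> 1" for b
    using a le by (simp add: br is_arg_max_def)
  then have "\<epsilon> * fst (a (individual \<epsilon> True)) + (1 - \<epsilon>) * fst (a (individual \<epsilon> False))
      \<le> \<epsilon> * 1 + (1 - \<epsilon>) * 1"
    using assms(1,2) by (intro add_mono mult_left_mono) auto
  then show "improvement (population \<epsilon>) a \<le> 1"
    using a by (simp add: br impr)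
qed

section \<open>The two cost structures\<close>

definition gaming_after_improving :: cost_structure where
  "gaming_after_improving =
     \<lparr>cost = \<lambda>a1 a2. if a1 = 1 \<or> a1 = 0 \<and> a2 = 0 then 0 else 1, budget = 0\<rparr>"

text \<open>The cost 2 exceeds the budget, so any nonzero \<open>a2\<close> is unaffordable and
  \<open>x2\<close> moves only through the outcome.\<close>

definition no_gaming :: cost_structure where
  "no_gaming = \<lparr>cost = \<lambda>a1 a2. if a2 = 0 then \<bar>a1\<bar> else 2, budget = 1\<rparr>"

lemma feasible_gaming_after_improving:
  "feasible gaming_after_improving a \<longleftrightarrow> fst a = 1 \<or> a = (0, 0)"
  by (cases a) (auto simp: gaming_after_improving_def)

lemma feasible_no_gaming: "feasible no_gaming a \<longleftrightarrow> \<bar>fst a\<bar> \<le> 1 \<and> snd a = 0"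
  by (cases a) (auto simp: no_gaming_def)

declare feasible.simps [simp del]

section \<open>Item 1: low risk excludes improvement of the common individuals\<close>

lemma risk_ge_if_common_improve:
  assumes \<epsilon>: "0 < \<epsilon>" "\<epsilon> < 1 / 2"
    and a: "best_response (population \<epsilon>) gaming_after_improving f a"
    and common: "fst (a (individual \<epsilon> False)) = 1"
  shows "ennreal (\<epsilon> / 4) \<le> risk (population \<epsilon>) f a"
proof -
  have meas: "a \<in> borel_measurable (exogenous (population \<epsilon>))"
    and opt: "\<And>b. is_arg_max (\<lambda>a'. score f (variables (population \<epsilon>) (individual \<epsilon> b) a'))
      (feasible gaming_after_improving) (a (individual \<epsilon> b))"
    using a \<epsilon> by (auto simp: best_response_population)
  define e where "e b = score f (reached \<epsilon> a b) - outcome (reached \<epsilon> a b)" for b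
  \<comment> \<open>The rare noise is smaller by 1, so a rare individual copies the common features
    by taking \<open>a1 = 1\<close> and adding 1 to the common \<open>a2\<close>.\<close>
  have "score f (reached \<epsilon> a False) =
      score f (variables (population \<epsilon>) (individual \<epsilon> True) (1, snd (a (individual \<epsilon> False)) + 1))"
    using common by (simp add: variables_population noise_def add_ac)
  also have "\<dots> \<le> score f (reached \<epsilon> a True)"
    using opt[of True] by (auto simp: is_arg_max_def not_less feasible_gaming_after_improving)
  \<comment> \<open>The common outcome is 1 + \<epsilon>. The rare one is \<epsilon> if
    \<open>a1 = 1\<close>, and \<epsilon> - 1 for the action \<open>(0, 0)\<close>.\<close>
  moreover have "outcome (reached \<epsilon> a True) \<le> outcome (reached \<epsilon> a False) - 1"
    using opt[of True] common
    by (auto simp: is_arg_max_def feasible_gaming_after_improving variables_population noise_def)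
  ultimately have "e False + 1 \<le> e True"
    by (simp add: e_def)
  then have "1 / 2 \<le> \<bar>e False\<bar> \<or> 1 / 2 \<le> \<bar>e True\<bar>"
    by linarith
  then obtain b where "1 / 2 \<le> \<bar>e b\<bar>"
    by blast
  then have "(1 / 2)\<^sup>2 \<le> \<bar>e b\<bar>\<^sup>2"
    by (rule power_mono) simp
  then have "1 / 4 \<le> (e b)\<^sup>2"
    by (simp add: power2_eq_square)
  \<comment> \<open>The common group has mass 1 - \<epsilon>, which exceeds \<epsilon> since
    \<epsilon> < 1/2. So whichever group is misjudged contributes at least \<epsilon>/4.\<close>
  moreover have "\<epsilon> \<le> pmf (bernoulli_pmf \<epsilon>) b"
    using \<epsilon> by (cases b) auto
  ultimately have "\<epsilon> * (1 / 4) \<le> pmf (bernoulli_pmf \<epsilon>) b * (e b)\<^sup>2"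
    using \<epsilon> by (intro mult_mono) auto
  then have "ennreal (\<epsilon> / 4) \<le> ennreal (pmf (bernoulli_pmf \<epsilon>) b * (e b)\<^sup>2)"
    by (intro ennreal_leI) simp
  also have "\<dots> \<le> risk (population \<epsilon>) f a"
    unfolding e_def using meas by (rule risk_ge_atom)
  finally show ?thesis .
qed

text \<open>Affordable actions have \<open>a1\<close> equal to 0 or 1. Low risk forces 0 on the
  common individuals, leaving at most 1 for a group of mass \<epsilon>.\<close>

lemma improvement_le_if_low_risk:
  assumes \<epsilon>: "0 < \<epsilon>" "\<epsilon> < 1 / 2"
    and a: "best_response (population \<epsilon>) gaming_after_improving f a"
    and low: "risk (population \<epsilon>) f a < ennreal (\<epsilon> / 4)"
  shows "improvement (population \<epsilon>) a \<le> \<epsilon>"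
proof -
  have feas: "fst (a (individual \<epsilon> b)) = 1 \<or> fst (a (individual \<epsilon> b)) = 0" for b
    using a \<epsilon> by (auto simp: best_response_population is_arg_max_def feasible_gaming_after_improving)
  have "fst (a (individual \<epsilon> False)) = 0"
    using feas[of False] risk_ge_if_common_improve[OF \<epsilon> a] low by (auto simp: not_le)
  then show ?thesis
    using a \<epsilon> feas[of True] by (auto simp: best_response_population improvement_population)
qed

section \<open>Item 2: the proxy as a mechanism\<close>

text \<open>With \<open>a2 = 0\<close> and no noise in the proxy, the score is exactly the outcome.
  It increases with \<open>a1\<close>, so both individuals choose \<open>a1 = 1\<close>.\<close>

lemma proxy_mechanism_no_gaming:
  assumes \<epsilon>: "0 < \<epsilon>" "\<epsilon> < 1"
  shows "for_all_responses (population \<epsilon>) no_gaming (\<lambda>x1 x2. x2)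
     (\<lambda>a. risk (population \<epsilon>) (\<lambda>x1 x2. x2) a = 0 \<and> improvement (population \<epsilon>) a = 1)"
  unfolding for_all_responses_def
proof (intro conjI exI allI impI)
  note br = best_response_population[OF \<epsilon>]
  show "best_response (population \<epsilon>) no_gaming (\<lambda>x1 x2. x2) (\<lambda>_. (1, 0))"
    unfolding br by (auto simp: is_arg_max_def variables_population feasible_no_gaming)
  fix a
  assume a: "best_response (population \<epsilon>) no_gaming (\<lambda>x1 x2. x2) a"
  then have meas: "a \<in> borel_measurable (exogenous (population \<epsilon>))"
    by (simp add: br)
  have act: "a (individual \<epsilon> b) = (1, 0)" for b
  proof -
    have "is_arg_max (\<lambda>a'. fst a' + noise \<epsilon> b + snd a') (feasible no_gaming) (a (individual \<epsilon> b))"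
      using a by (simp add: br variables_population)
    moreover have "feasible no_gaming (1, 0)"
      by (simp add: feasible_no_gaming)
    \<comment> \<open>Comparison with \<open>(1, 0)\<close> gives \<open>a1 + a2\<close> at least 1.
      Feasibility then leaves \<open>(1, 0)\<close> as the only maximizer.\<close>
    ultimately have "\<not> fst (a (individual \<epsilon> b)) + snd (a (individual \<epsilon> b)) < 1"
        "\<bar>fst (a (individual \<epsilon> b))\<bar> \<le> 1" "snd (a (individual \<epsilon> b)) = 0"
      by (force simp: is_arg_max_def feasible_no_gaming)+
    then show ?thesis
      by (simp add: prod_eq_iff)
  qed
  have [measurable]: "score (\<lambda>x1 x2. x2) \<in> borel_measurable borel"
  proof -
    have *: "score (\<lambda>x1 x2. x2) = (\<lambda>z. fst (snd z))"
      by auto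
    show ?thesis
      unfolding * by (intro borel_measurable_continuous_onI continuous_intros)
  qed
  show "risk (population \<epsilon>) (\<lambda>x1 x2. x2) a = 0"
    by (simp add: risk_def induced_population[OF meas] nn_integral_distr variables_population act)
  show "improvement (population \<epsilon>) a = 1"
    by (simp add: improvement_population[OF \<epsilon> meas] act)
qed

section \<open>Passage to the limit \<epsilon> to 0\<close>

lemma eventually_at_right_0_less:
  fixes c :: real
  assumes "0 < c"
  shows "\<forall>\<^sub>F \<epsilon> in at_right 0. 0 < \<epsilon> \<and> \<epsilon> < c"
  using eventually_at_right_real[OF assms] by (rule eventually_mono) simp

theorem proposition2:
  shows
    "(\<exists>(M :: real \<Rightarrow> model) (C :: real \<Rightarrow> cost_structure).
        (\<forall>\<^sub>F \<epsilon> in at_right 0. linear_scm (M \<epsilon>) \<and> optimal_improvement (M \<epsilon>) (C \<epsilon>) 1) \<and>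
        (\<forall>f a (r :: real \<Rightarrow> real).
           (\<forall>\<^sub>F \<epsilon> in at_right 0. best_response (M \<epsilon>) (C \<epsilon>) (f \<epsilon>) (a \<epsilon>)) \<and>
           (\<forall>\<^sub>F \<epsilon> in at_right 0. risk (M \<epsilon>) (f \<epsilon>) (a \<epsilon>) \<le> ennreal (r \<epsilon>)) \<and>
           r \<in> o[at_right 0](\<lambda>\<epsilon>. \<epsilon>) \<longrightarrow>
           (\<exists>g \<in> O[at_right 0](\<lambda>\<epsilon>. \<epsilon>).
              \<forall>\<^sub>F \<epsilon> in at_right 0. improvement (M \<epsilon>) (a \<epsilon>) \<le> g \<epsilon>)))
     \<and>
     (\<exists>(M :: real \<Rightarrow> model) (C :: real \<Rightarrow> cost_structure).
        (\<forall>\<^sub>F \<epsilon> in at_right 0. linear_scm (M \<epsilon>) \<and> optimal_improvement (M \<epsilon>) (C \<epsilon>) 1) \<and>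
        (\<exists>(h :: real \<Rightarrow> real \<Rightarrow> real) (r :: real \<Rightarrow> real).
           r \<in> o[at_right 0](\<lambda>\<epsilon>. \<epsilon>) \<and>
           (\<forall>\<^sub>F \<epsilon> in at_right 0.
              h \<epsilon> \<in> borel_measurable borel \<and>
              for_all_responses (M \<epsilon>) (C \<epsilon>) (\<lambda>x1 x2. h \<epsilon> x2)
                (\<lambda>a. risk (M \<epsilon>) (\<lambda>x1 x2. h \<epsilon> x2) a \<le> ennreal (r \<epsilon>) \<and>
                     improvement (M \<epsilon>) a \<ge> 1 - \<epsilon>))))"
proof (rule conjI)
  show "\<exists>(M :: real \<Rightarrow> model) (C :: real \<Rightarrow> cost_structure).
      (\<forall>\<^sub>F \<epsilon> in at_right 0. linear_scm (M \<epsilon>) \<and> optimal_improvement (M \<epsilon>) (C \<epsilon>) 1) \<and>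
      (\<forall>f a (r :: real \<Rightarrow> real).
         (\<forall>\<^sub>F \<epsilon> in at_right 0. best_response (M \<epsilon>) (C \<epsilon>) (f \<epsilon>) (a \<epsilon>)) \<and>
         (\<forall>\<^sub>F \<epsilon> in at_right 0. risk (M \<epsilon>) (f \<epsilon>) (a \<epsilon>) \<le> ennreal (r \<epsilon>)) \<and>
         r \<in> o[at_right 0](\<lambda>\<epsilon>. \<epsilon>) \<longrightarrow>
         (\<exists>g \<in> O[at_right 0](\<lambda>\<epsilon>. \<epsilon>).
            \<forall>\<^sub>F \<epsilon> in at_right 0. improvement (M \<epsilon>) (a \<epsilon>) \<le> g \<epsilon>))"
  proof (intro exI[of _ population] exI[of _ "\<lambda>_. gaming_after_improving"] conjI allI impI)
    show "\<forall>\<^sub>F \<epsilon> in at_right 0. linear_scm (population \<epsilon>) \<and>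
        optimal_improvement (population \<epsilon>) gaming_after_improving 1"
      using eventually_at_right_0_less[OF zero_less_one]
      by (rule eventually_mono)
        (auto intro!: linear_scm_population optimal_improvement_population
          simp: feasible_gaming_after_improving)
  next
    fix f a and r :: "real \<Rightarrow> real"
    assume "(\<forall>\<^sub>F \<epsilon> in at_right 0. best_response (population \<epsilon>) gaming_after_improving (f \<epsilon>) (a \<epsilon>)) \<and>
      (\<forall>\<^sub>F \<epsilon> in at_right 0. risk (population \<epsilon>) (f \<epsilon>) (a \<epsilon>) \<le> ennreal (r \<epsilon>)) \<and>
      r \<in> o[at_right 0](\<lambda>\<epsilon>. \<epsilon>)"
    then have "\<forall>\<^sub>F \<epsilon> in at_right 0. best_response (population \<epsilon>) gaming_after_improving (f \<epsilon>) (a \<epsilon>)"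
      and "\<forall>\<^sub>F \<epsilon> in at_right 0. risk (population \<epsilon>) (f \<epsilon>) (a \<epsilon>) \<le> ennreal (r \<epsilon>)"
      \<comment> \<open>Any positive constant below 1/4 would do; it makes the risk strictly smaller
        than \<epsilon>/4.\<close>
      and "\<forall>\<^sub>F \<epsilon> in at_right 0. norm (r \<epsilon>) \<le> 1 / 8 * norm \<epsilon>"
      by (auto dest: landau_o.smallD[where c = "1 / 8"])
    moreover have "\<forall>\<^sub>F \<epsilon> :: real in at_right 0. 0 < \<epsilon> \<and> \<epsilon> < 1 / 2"
      by (rule eventually_at_right_0_less) simp
    ultimately have "\<forall>\<^sub>F \<epsilon> in at_right 0. improvement (population \<epsilon>) (a \<epsilon>) \<le> \<epsilon>"
    proof eventually_elim
      case (elim \<epsilon>)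
      \<comment> \<open>\<open>ennreal\<close> sends negative reals to 0; passing to the absolute
        value covers every sign of \<open>r \<epsilon>\<close>.\<close>
      have "risk (population \<epsilon>) (f \<epsilon>) (a \<epsilon>) \<le> ennreal (\<bar>r \<epsilon>\<bar>)"
        using elim(2) by (rule order_trans) (simp add: ennreal_leI)
      also have "\<dots> < ennreal (\<epsilon> / 4)"
        using elim(3,4) by (intro ennreal_lessI) auto
      finally show ?case
        using elim(1,4) by (intro improvement_le_if_low_risk) auto
    qed
    then show "\<exists>g \<in> O[at_right 0](\<lambda>\<epsilon>. \<epsilon>).
        \<forall>\<^sub>F \<epsilon> in at_right 0. improvement (population \<epsilon>) (a \<epsilon>) \<le> g \<epsilon>"
      by (intro bexI[of _ "\<lambda>\<epsilon>. \<epsilon>"]) auto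
  qed
next
  show "\<exists>(M :: real \<Rightarrow> model) (C :: real \<Rightarrow> cost_structure).
      (\<forall>\<^sub>F \<epsilon> in at_right 0. linear_scm (M \<epsilon>) \<and> optimal_improvement (M \<epsilon>) (C \<epsilon>) 1) \<and>
      (\<exists>(h :: real \<Rightarrow> real \<Rightarrow> real) (r :: real \<Rightarrow> real).
         r \<in> o[at_right 0](\<lambda>\<epsilon>. \<epsilon>) \<and>
         (\<forall>\<^sub>F \<epsilon> in at_right 0.
            h \<epsilon> \<in> borel_measurable borel \<and>
            for_all_responses (M \<epsilon>) (C \<epsilon>) (\<lambda>x1 x2. h \<epsilon> x2)
              (\<lambda>a. risk (M \<epsilon>) (\<lambda>x1 x2. h \<epsilon> x2) a \<le> ennreal (r \<epsilon>) \<and>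
                   improvement (M \<epsilon>) a \<ge> 1 - \<epsilon>)))"
  proof (intro exI[of _ population] exI[of _ "\<lambda>_. no_gaming"] exI[of _ "\<lambda>_ x2. x2"]
      exI[of _ "\<lambda>_. 0"] conjI)
    show "\<forall>\<^sub>F \<epsilon> in at_right 0. linear_scm (population \<epsilon>) \<and>
        optimal_improvement (population \<epsilon>) no_gaming 1"
      using eventually_at_right_0_less[OF zero_less_one]
      by (rule eventually_mono)
        (auto intro!: linear_scm_population optimal_improvement_population
          simp: feasible_no_gaming)
    show "\<forall>\<^sub>F \<epsilon> in at_right 0.
        (\<lambda>x2 :: real. x2) \<in> borel_measurable borel \<and>
        for_all_responses (population \<epsilon>) no_gaming (\<lambda>x1 x2. x2)
          (\<lambda>a. risk (population \<epsilon>) (\<lambda>x1 x2. x2) a \<le> ennreal 0 \<and>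
               improvement (population \<epsilon>) a \<ge> 1 - \<epsilon>)"
      using eventually_at_right_0_less[OF zero_less_one]
      by (rule eventually_mono)
        (use proxy_mechanism_no_gaming in \<open>auto simp: for_all_responses_def\<close>)
  qed simp
qed

end
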